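(* Let $k\geq 2$ and let $\mathcal{C}_k$ be the class of finite kay-graphs. For every $\mathbf{A}\in\mathcal{C}_k$ with $\ell$ vertices, put $\rho(\mathbf{A})=2^{-\binom{\ell-1}{k-1}}$. Then for every $\varepsilon>0$ there is $\mathbf{B}\in\mathcal{C}_k$ into which $\mathbf{A}$ embeds such that for every hypergraphing $\mathbf{A}^*$ of $\mathbf{A}$ and every hypergraphing $\mathbf{B}^*$ of $\mathbf{B}$, \[\left|\frac{N(\mathbf{A}^*,\mathbf{B}^* )}{N(\mathbf{A},\mathbf{B})}-\rho(\mathbf{A})\right|\leq\varepsilon.\]
   Context: A kay-graph (for $k\geq2$) is a $(k+1)$-uniform hypergraph such that the number of hyperedges on any set of $k+2$ vertices has the same parity as $k$. Given a $k$-uniform hypergraph $\mathbf{H}$, the associated kay-graph is the $(k+1)$-uniform hypergraph on the same vertices in which a $(k+1)$-set is a hyperedge iff the number of hyperedges of $\mathbf{H}$ contained in it has the same parity as $k+1$. A $k$-uniform hypergraph $\mathbf{H}$ is a hypergraphing of (compatible with) a kay-graph $\mathbf{G}$ if $\mathbf{G}$ is the kay-graph associated to $\mathbf{H}$. $N(\mathbf{A},\mathbf{B})$ is the number of embeddings (injective maps preserving hyperedges and non-hyperedges) of $\mathbf{A}$ into $\mathbf{B}$, and $N(\mathbf{A}^*,\mathbf{B}^* )$ is the number of embeddings of the $k$-uniform hypergraph $\mathbf{A}^*$ into $\mathbf{B}^*$. *)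

theory Defs
  imports Complex_Main "HOL-Library.FuncSet" "HOL-Library.Ramsey"
begin

record 'a hypergraph =
  verts :: "'a set"
  edges :: "'a set set"

definition uniform :: "nat \<Rightarrow> 'a hypergraph \<Rightarrow> bool" where
  "uniform r H \<longleftrightarrow> edges H \<subseteq> nsets (verts H) r"

definition edges_in :: "'a hypergraph \<Rightarrow> 'a set \<Rightarrow> 'a set set" where
  "edges_in H S = {e \<in> edges H. e \<subseteq> S}"

definition kay_graph :: "nat \<Rightarrow> 'a hypergraph \<Rightarrow> bool" where
  "kay_graph k G \<longleftrightarrow> uniform (k + 1) G \<and>
     (\<forall>S \<in> nsets (verts G) (k + 2). even (card (edges_in G S)) \<longleftrightarrow> even k)"

definition finite_kay_graphs :: "nat \<Rightarrow> 'a hypergraph set" where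
  "finite_kay_graphs k = {G. kay_graph k G \<and> finite (verts G)}"

definition associated_kay_graph :: "nat \<Rightarrow> 'a hypergraph \<Rightarrow> 'a hypergraph" where
  "associated_kay_graph k H =
     \<lparr>verts = verts H,
      edges = {S \<in> nsets (verts H) (k + 1).
                 even (card (edges_in H S)) \<longleftrightarrow> even (k + 1)}\<rparr>"

definition hypergraphing :: "nat \<Rightarrow> 'a hypergraph \<Rightarrow> 'a hypergraph \<Rightarrow> bool" where
  "hypergraphing k H G \<longleftrightarrow> uniform k H \<and> associated_kay_graph k H = G"

text \<open>Embeddings of \<open>r\<close>-uniform hypergraphs. The maps are extensional (\<open>undefined\<close>
  outside \<open>verts A\<close>), so that each map between the vertex sets is counted exactly once.\<close>

definition embeddings ::
  "nat \<Rightarrow> 'a hypergraph \<Rightarrow> 'b hypergraph \<Rightarrow> ('a \<Rightarrow> 'b) set" where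
  "embeddings r A B =
     {f \<in> verts A \<rightarrow>\<^sub>E verts B. inj_on f (verts A) \<and>
        (\<forall>e \<in> nsets (verts A) r. e \<in> edges A \<longleftrightarrow> f ` e \<in> edges B)}"

definition num_embeddings :: "nat \<Rightarrow> 'a hypergraph \<Rightarrow> 'b hypergraph \<Rightarrow> nat" where
  "num_embeddings r A B = card (embeddings r A B)"

text \<open>For the empty kay-graph the truncated subtraction gives \<open>0 choose (k - 1) = 0\<close>,
  which agrees with the combinatorial convention that the binomial coefficient of
  \<open>-1\<close> over \<open>k - 1\<close> vanishes.\<close>

definition rho :: "nat \<Rightarrow> 'a hypergraph \<Rightarrow> real" where
  "rho k A = 1 / 2 ^ ((card (verts A) - 1) choose (k - 1))"

end

theory Submission
  imports Defs
begin

text \<open>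
  The parity condition makes the hypergraphings of a kay-graph a torsor over the cocycles modulo 2.
  Coning from a vertex \<open>v\<close>, a hypergraphing is given by an arbitrary choice of its hyperedges
  through \<open>v\<close>, so \<open>A\<close> has exactly \<open>1 / rho k A\<close> hypergraphings \<open>A'\<close>, and for each
  hypergraphing \<open>B'\<close> of \<open>B\<close> every embedding of \<open>A\<close> into \<open>B\<close> embeds precisely one of them
  into \<open>B'\<close>. It remains to make all the numbers \<open>N(A', B')\<close> nearly equal.

  Take \<open>B\<close> associated to a random \<open>k\<close>-uniform hypergraph \<open>E\<close> on \<open>n\<close> vertices. Switching
  one hyperedge \<open>e\<close> of \<open>A'\<close> changes \<open>N(A', B')\<close> by a sum, over the placements of the vertices outside
  \<open>e\<close>, of signed counts of the maps \<open>y\<close> of \<open>e\<close>, with sign given by whether \<open>y ` e\<close> is a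
  hyperedge of \<open>B'\<close> and with constraints that see \<open>y\<close> only on proper subsets of \<open>e\<close>.
  There are \<open>exp (O (n ^ (k - 1)))\<close> constraint families and equally few cocycles, whereas
  by a Chernoff bound a fixed signed count exceeds \<open>\<delta> * n ^ k\<close> with
  probability \<open>exp (- c * n ^ k)\<close>; hence some \<open>E\<close> is good for all of them at once.
\<close>

section \<open>Hypergraphings and cocycles\<close>

lemma nsets_iff: "e \<in> nsets V r \<longleftrightarrow> e \<subseteq> V \<and> finite e \<and> card e = r"
  by (auto simp: nsets_def)

lemma uniform_edge: "uniform r H \<Longrightarrow> e \<in> edges H \<Longrightarrow> e \<subseteq> verts H \<and> finite e \<and> card e = r"
  by (auto simp: uniform_def nsets_def)

lemma finite_edges_in: "finite S \<Longrightarrow> finite (edges_in H S)"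
  by (rule finite_subset[of _ "Pow S"]) (auto simp: edges_in_def)

lemma edges_in_self:
  assumes "uniform r H" "finite e" "card e = r"
  shows "edges_in H e = (if e \<in> edges H then {e} else {})"
  using assms by (auto simp: edges_in_def dest: uniform_edge card_subset_eq)

text \<open>Hyperedges through \<open>v\<close> correspond to their traces on \<open>S\<close>. This
  later lets the parity condition on a cone be solved for its base.\<close>

lemma card_edges_in_insert:
  assumes "uniform (Suc r) H" "finite S" "v \<notin> S"
  shows "card (edges_in H (insert v S)) =
    card (edges_in H S) + card {T \<in> nsets S r. insert v T \<in> edges H}"
proof -
  let ?X = "{T \<in> nsets S r. insert v T \<in> edges H}"
  have "edges_in H (insert v S) = edges_in H S \<union> insert v ` ?X"
  proof (intro equalityI subsetI)
    fix e assume e: "e \<in> edges_in H (insert v S)"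
    show "e \<in> edges_in H S \<union> insert v ` ?X"
    proof (cases "v \<in> e")
      case True
      then have "e = insert v (e - {v})" by auto
      moreover have "e - {v} \<in> ?X"
        using e True uniform_edge[OF assms(1), of e]
        by (auto simp: edges_in_def nsets_iff insert_absorb)
      ultimately show ?thesis by blast
    qed (use e in \<open>auto simp: edges_in_def\<close>)
  qed (auto simp: edges_in_def nsets_iff)
  moreover have "edges_in H S \<inter> insert v ` ?X = {}"
    using assms(3) by (auto simp: edges_in_def)
  moreover have "finite ?X"
    using assms(2) by (simp add: finite_imp_finite_nsets)
  moreover have "card (insert v ` ?X) = card ?X"
  proof (rule card_image, rule inj_onI)
    fix T T' assume "T \<in> ?X" "T' \<in> ?X" and eq: "insert v T = insert v T'"
    then have "v \<notin> T" "v \<notin> T'" using assms(3) by (auto simp: nsets_iff)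
    with eq show "T = T'" by (metis insert_ident)
  qed
  ultimately show ?thesis
    by (simp add: card_Un_disjoint finite_edges_in[OF assms(2)])
qed

text \<open>Such a \<open>T\<close> is \<open>e\<close> together with one of the two points of
  \<open>S - e\<close>. That this count is even is why the coboundary of a coboundary vanishes
  modulo 2.\<close>

lemma card_intermediate_nsets:
  assumes "finite S" "e \<subseteq> S" "card e = k" "card S = k + 2"
  shows "card {T \<in> nsets S (k + 1). e \<subseteq> T} = 2"
proof -
  have fe: "finite e" using assms finite_subset by blast
  have "{T \<in> nsets S (k + 1). e \<subseteq> T} = (\<lambda>x. insert x e) ` (S - e)"
  proof (intro equalityI subsetI)
    fix T assume T: "T \<in> {T \<in> nsets S (k + 1). e \<subseteq> T}"
    then have "card (T - e) = 1"
      using fe assms(3) by (auto simp: nsets_iff card_Diff_subset)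
    then obtain x where "T - e = {x}" by (auto simp: card_1_singleton_iff)
    with T have "T = insert x e" "x \<in> S - e" by (auto simp: nsets_iff)
    then show "T \<in> (\<lambda>x. insert x e) ` (S - e)" by blast
  qed (use assms fe in \<open>auto simp: nsets_iff\<close>)
  moreover have "inj_on (\<lambda>x. insert x e) (S - e)"
    by (auto intro!: inj_onI)
  ultimately show ?thesis
    using assms fe by (simp add: card_image card_Diff_subset)
qed

text \<open>Each hyperedge of \<open>H\<close> inside \<open>S\<close> lies in exactly two of the
  (k+1)-subsets \<open>T\<close> of \<open>S\<close>, so the numbers of hyperedges in these
  \<open>T\<close> have an even sum. What remains is the shift by \<open>k\<close>, taken
  \<open>k + 2\<close> times.\<close>

lemma kay_graph_associated:
  assumes "uniform k H"
  shows "kay_graph k (associated_kay_graph k H)"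
proof -
  let ?G = "associated_kay_graph k H"
  have "even (card (edges_in ?G S)) \<longleftrightarrow> even k" if "S \<in> nsets (verts H) (k + 2)" for S
  proof -
    have S: "S \<subseteq> verts H" "finite S" "card S = k + 2"
      using that by (auto simp: nsets_iff)
    let ?N = "nsets S (k + 1)"
    have fN: "finite ?N" using S(2) by (rule finite_imp_finite_nsets)
    have fE: "finite (edges_in H S)" using S(2) by (rule finite_edges_in)
    have "(\<Sum>T\<in>?N. card (edges_in H T)) = (\<Sum>T\<in>?N. card {e \<in> edges_in H S. e \<subseteq> T})"
      by (intro sum.cong refl arg_cong[where f = card]) (auto simp: edges_in_def nsets_iff)
    also have "\<dots> = (\<Sum>e\<in>edges_in H S. card {T \<in> ?N. e \<subseteq> T})"
      using sum_multicount_gen[OF fN fE, of "\<lambda>T e. e \<subseteq> T" "\<lambda>e. card {T \<in> ?N. e \<subseteq> T}"] by simp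
    also have "\<dots> = (\<Sum>e\<in>edges_in H S. 2)"
    proof (rule sum.cong)
      fix e assume "e \<in> edges_in H S"
      then show "card {T \<in> ?N. e \<subseteq> T} = 2"
        using S uniform_edge[OF assms, of e]
        by (intro card_intermediate_nsets) (auto simp: edges_in_def)
    qed simp
    finally have ev: "even (\<Sum>T\<in>?N. card (edges_in H T))" by simp
    \<comment> \<open>The hyperedges of \<open>?G\<close> are the sets \<open>T\<close> with an odd
      term \<open>card (edges_in H T) + k\<close>, so their number has the parity of the sum of
      these terms.\<close>
    have "edges_in ?G S = {T \<in> ?N. odd (card (edges_in H T) + k)}"
      using S by (auto simp: edges_in_def associated_kay_graph_def nsets_iff)
    then have "even (card (edges_in ?G S)) \<longleftrightarrow> even (\<Sum>T\<in>?N. card (edges_in H T) + k)"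
      using even_sum_iff[OF fN, of "\<lambda>T. card (edges_in H T) + k"] by simp
    also have "\<dots> \<longleftrightarrow> even (card ?N * k)"
      using ev by (simp add: sum.distrib)
    also have "card ?N = k + 2"
      using S binomial_symmetric[of "k + 1" "k + 2"] by simp
    finally show ?thesis by simp
  qed
  moreover have "uniform (k + 1) ?G"
    by (auto simp: uniform_def associated_kay_graph_def)
  ultimately show ?thesis
    by (auto simp: kay_graph_def associated_kay_graph_def)
qed

lemma hypergraph_eqI: "verts A = verts B \<Longrightarrow> edges A = edges B \<Longrightarrow> A = (B :: 'a hypergraph)"
  by (cases A; cases B) simp

lemma hypergraphing_verts: "hypergraphing k H G \<Longrightarrow> verts H = verts G"
  by (auto simp: hypergraphing_def associated_kay_graph_def)

lemma hypergraphing_parity: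
  assumes "hypergraphing k H G" "S \<in> nsets (verts G) (k + 1)"
  shows "S \<in> edges G \<longleftrightarrow> (even (card (edges_in H S)) \<longleftrightarrow> even (k + 1))"
  using assms by (auto simp: hypergraphing_def associated_kay_graph_def)

text \<open>For \<open>S\<close> avoiding \<open>v\<close>, all other (k+1)-subsets of
  \<open>insert v S\<close> contain \<open>v\<close>, so the parity condition on
  \<open>insert v S\<close> decides whether \<open>S\<close> is a hyperedge.\<close>

lemma kay_graph_eqI:
  assumes "kay_graph k G" "kay_graph k G'" "verts G = verts G'" "v \<in> verts G"
    and eq: "\<And>S. S \<in> nsets (verts G) (k + 1) \<Longrightarrow> v \<in> S \<Longrightarrow> S \<in> edges G \<longleftrightarrow> S \<in> edges G'"
  shows "G = G'"
proof (rule hypergraph_eqI)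
  have "S \<in> edges G \<longleftrightarrow> S \<in> edges G'" if S: "S \<in> nsets (verts G) (k + 1)" for S
  proof (cases "v \<in> S")
    case False
    have fS: "finite S" and cS: "card S = Suc k" using S by (auto simp: nsets_iff)
    have ins: "insert v S \<in> nsets (verts G) (k + 2)"
      using S False assms(4) by (auto simp: nsets_iff)
    have u: "uniform (Suc k) G" "uniform (Suc k) G'"
      using assms by (auto simp: kay_graph_def)
    have "even (card (edges_in G (insert v S))) \<longleftrightarrow> even (card (edges_in G' (insert v S)))"
      using ins assms by (simp add: kay_graph_def)
    moreover have "{T \<in> nsets S k. insert v T \<in> edges G} = {T \<in> nsets S k. insert v T \<in> edges G'}"
    proof (rule Collect_cong, rule conj_cong[OF refl])
      fix T assume T: "T \<in> nsets S k"
      then have "v \<notin> T" using False by (auto simp: nsets_iff)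
      with T show "insert v T \<in> edges G \<longleftrightarrow> insert v T \<in> edges G'"
        using S assms(4) by (intro eq) (auto simp: nsets_iff)
    qed
    ultimately have "even (card (edges_in G S)) \<longleftrightarrow> even (card (edges_in G' S))"
      using card_edges_in_insert[OF u(1) fS False] card_edges_in_insert[OF u(2) fS False] by simp argo
    then show ?thesis
      using edges_in_self[OF u(1) fS cS] edges_in_self[OF u(2) fS cS] by (simp split: if_splits)
  qed (use eq S in blast)
  then show "edges G = edges G'"
    using assms by (auto simp: kay_graph_def uniform_def)
qed (fact assms)

text \<open>The link at \<open>v\<close> is a free coordinate on the hypergraphings: the parity condition on
  the sets \<open>insert v e\<close> determines all the other hyperedges.\<close>

definition link :: "nat \<Rightarrow> 'a \<Rightarrow> 'a hypergraph \<Rightarrow> 'a set set" where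
  "link r v H = {T \<in> nsets (verts H - {v}) r. insert v T \<in> edges H}"

text \<open>The only (Suc r)-subset of \<open>insert v e\<close> avoiding \<open>v\<close> is
  \<open>e\<close> itself; the link counts the others.\<close>

lemma hypergraphing_parity_cone:
  assumes "uniform (Suc r) H" "e \<in> nsets (verts H - {v}) (Suc r)"
  shows "even (card (edges_in H (insert v e))) \<longleftrightarrow>
    (e \<in> edges H \<longleftrightarrow> odd (card (link r v H \<inter> nsets e r)))"
proof -
  have "{T \<in> nsets e r. insert v T \<in> edges H} = link r v H \<inter> nsets e r"
    using assms(2) by (auto simp: link_def nsets_iff)
  moreover have "finite e" "v \<notin> e" "card e = Suc r"
    using assms(2) by (auto simp: nsets_iff)
  ultimately show ?thesis
    using card_edges_in_insert[OF assms(1), of e v] edges_in_self[OF assms(1), of e] by simp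
qed

text \<open>Injectivity solves the cone parity for every \<open>e\<close> avoiding \<open>v\<close>;
  surjectivity takes the same equation as the definition of the hyperedges avoiding
  \<open>v\<close>.\<close>

lemma bij_betw_hypergraphings_link:
  assumes G: "kay_graph (Suc r) G" and v: "v \<in> verts G"
  shows "bij_betw (link r v) {H. hypergraphing (Suc r) H G} (Pow (nsets (verts G - {v}) r))"
proof -
  let ?k = "Suc r" and ?V = "verts G"
  have inj: "H = H'"
    if H: "hypergraphing ?k H G" and H': "hypergraphing ?k H' G" and eq: "link r v H = link r v H'"
    for H H'
  proof (rule hypergraph_eqI)
    have vs: "verts H = ?V" "verts H' = ?V" using that by (simp_all add: hypergraphing_verts)
    have u: "uniform ?k H" "uniform ?k H'" using that by (auto simp: hypergraphing_def)
    have "e \<in> edges H \<longleftrightarrow> e \<in> edges H'" if e: "e \<in> nsets ?V ?k" for e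
    proof (cases "v \<in> e")
      case True
      then have "e - {v} \<in> nsets (?V - {v}) r" "insert v (e - {v}) = e"
        using e by (auto simp: nsets_iff)
      then show ?thesis using eq vs unfolding link_def by (metis (mono_tags, lifting) mem_Collect_eq)
    next
      case False
      then have e': "e \<in> nsets (?V - {v}) ?k" using e by (auto simp: nsets_iff)
      have "insert v e \<in> nsets ?V (?k + 1)" using e False v by (auto simp: nsets_iff)
      then have "even (card (edges_in H (insert v e))) \<longleftrightarrow> even (card (edges_in H' (insert v e)))"
        using hypergraphing_parity[OF H] hypergraphing_parity[OF H'] by blast
      then show ?thesis
        using hypergraphing_parity_cone[OF u(1), of e v] hypergraphing_parity_cone[OF u(2), of e v]
          e' vs eq by auto
    qed
    then show "edges H = edges H'"
      using u vs by (auto simp: uniform_def)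
    show "verts H = verts H'" using vs by simp
  qed
  have surj: "\<exists>H. hypergraphing ?k H G \<and> link r v H = P" if P: "P \<subseteq> nsets (?V - {v}) r" for P
  proof -
    \<comment> \<open>Whether \<open>e\<close> avoiding \<open>v\<close> is a hyperedge is dictated
      by the parity that \<open>G\<close> prescribes on \<open>insert v e\<close>.\<close>
    define H where "H = \<lparr>verts = ?V, edges = insert v ` P \<union>
      {e \<in> nsets (?V - {v}) ?k.
        odd (card (P \<inter> nsets e r)) \<longleftrightarrow> (insert v e \<in> edges G \<longleftrightarrow> even (?k + 1))}\<rparr>"
    have vH: "verts H = ?V" by (simp add: H_def)
    have uH: "uniform ?k H"
    proof -
      have "insert v T \<in> nsets ?V ?k" if "T \<in> P" for T
      proof -
        have "T \<in> nsets (?V - {v}) r" using that P by blast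
        then show ?thesis using v by (auto simp: nsets_iff card_insert_if)
      qed
      then show ?thesis by (auto simp: uniform_def H_def nsets_iff)
    qed
    have lH: "link r v H = P"
    proof -
      have "T \<in> P" if T: "T \<in> nsets (?V - {v}) r" and vT: "insert v T \<in> edges H" for T
      proof -
        have "insert v T \<notin> nsets (?V - {v}) ?k" by (simp add: nsets_iff)
        then have "insert v T \<in> insert v ` P" using vT unfolding H_def by simp
        then obtain T' where T': "T' \<in> P" "insert v T = insert v T'" by blast
        then have "T' \<in> nsets (?V - {v}) r" using P by blast
        then have "v \<notin> T'" "v \<notin> T" using T unfolding nsets_iff by blast+
        then show ?thesis using T' by (metis insert_ident)
      qed
      then show ?thesis using P by (auto simp: link_def vH) (simp add: H_def)
    qed
    have "G = associated_kay_graph ?k H"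
    \<comment> \<open>By construction the parities are right on the sets through \<open>v\<close>;
      agreement on the others follows because both sides are kay-graphs.\<close>
    proof (rule kay_graph_eqI[OF G kay_graph_associated[OF uH] _ v])
      fix S assume S: "S \<in> nsets ?V (?k + 1)" "v \<in> S"
      define e where "e = S - {v}"
      have e: "e \<in> nsets (verts H - {v}) ?k" "S = insert v e" "v \<notin> e"
        using S by (auto simp: e_def vH nsets_iff)
      have "e \<in> edges H \<longleftrightarrow>
          (odd (card (P \<inter> nsets e r)) \<longleftrightarrow> (insert v e \<in> edges G \<longleftrightarrow> even (?k + 1)))"
        using e vH by (auto simp: H_def)
      then show "S \<in> edges G \<longleftrightarrow> S \<in> edges (associated_kay_graph ?k H)"
        using hypergraphing_parity_cone[OF uH e(1)] S e(2) lH vH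
        by (auto simp: associated_kay_graph_def)
    qed (simp add: associated_kay_graph_def vH)
    then show ?thesis using uH lH unfolding hypergraphing_def by blast
  qed
  show ?thesis
    unfolding bij_betw_def
  proof (intro conjI inj_onI equalityI subsetI)
    fix P assume "P \<in> Pow (nsets (?V - {v}) r)"
    then show "P \<in> link r v ` {H. hypergraphing (Suc r) H G}" using surj[of P] by blast
  qed (use inj in \<open>auto simp: link_def hypergraphing_verts\<close>)
qed

lemma card_hypergraphings:
  assumes G: "kay_graph k G" and "finite (verts G)" and k: "k \<ge> 2"
  shows "card {H. hypergraphing k H G} = 2 ^ ((card (verts G) - 1) choose (k - 1))"
proof -
  obtain r where r: "k = Suc r" using k by (cases k) auto
  show ?thesis
  proof (cases "verts G = {}")
    \<comment> \<open>There is no vertex to cone from. The empty hypergraph is the only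
      hypergraphing, and the exponent is \<open>0 choose (k - 1)\<close>, which is 0 since
      \<open>k \<ge> 2\<close>.\<close>
    case True
    then have "G = \<lparr>verts = {}, edges = {}\<rparr>"
      using G by (intro hypergraph_eqI) (auto simp: kay_graph_def uniform_def nsets_iff)
    then have "{H. hypergraphing k H G} = {\<lparr>verts = {}, edges = {}\<rparr>}"
      using k by (auto simp: hypergraphing_def associated_kay_graph_def uniform_def nsets_iff
          intro!: hypergraph_eqI)
    then show ?thesis using True k by (simp add: binomial_eq_0)
  next
    case False
    then obtain v where v: "v \<in> verts G" by blast
    have "card {H. hypergraphing k H G} = card (Pow (nsets (verts G - {v}) r))"
      using bij_betw_same_card[OF bij_betw_hypergraphings_link[OF _ v]] G r by simp
    then show ?thesis
      using assms v r by (simp add: card_Pow finite_imp_finite_nsets)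
  qed
qed

text \<open>The cocycles modulo 2, encoded as the hypergraphings of the kay-graph of the empty
  hypergraph; they are the differences of two hypergraphings of one kay-graph.\<close>

definition cocycles :: "nat \<Rightarrow> 'a set \<Rightarrow> 'a set set set" where
  "cocycles k V = edges ` {H. hypergraphing k H (associated_kay_graph k \<lparr>verts = V, edges = {}\<rparr>)}"

text \<open>The exponent has degree \<open>k - 1\<close> in the number of vertices, one below the
  degree \<open>k\<close> gained from the Chernoff bound, so a union bound over all cocycles is
  affordable.\<close>

lemma card_cocycles_le:
  assumes "finite V" "k \<ge> 2" "k \<le> card V"
  shows "card (cocycles k V) \<le> 2 ^ (card V ^ (k - 1))" "finite (cocycles k V)"
proof -
  let ?G = "associated_kay_graph k \<lparr>verts = V, edges = {}\<rparr>"
  have G: "kay_graph k ?G" by (rule kay_graph_associated) (simp add: uniform_def)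
  have c: "card {H. hypergraphing k H ?G} = 2 ^ ((card V - 1) choose (k - 1))"
    using card_hypergraphings[OF G] assms by (simp add: associated_kay_graph_def)
  then have fin: "finite {H. hypergraphing k H ?G}"
    by (intro card_ge_0_finite) simp
  then show "finite (cocycles k V)" by (simp add: cocycles_def)
  have "(card V - 1) choose (k - 1) \<le> (card V - 1) ^ (k - 1)"
    using assms by (intro binomial_le_pow) auto
  also have "\<dots> \<le> card V ^ (k - 1)" by (intro power_mono) auto
  finally have "(2::nat) ^ ((card V - 1) choose (k - 1)) \<le> 2 ^ (card V ^ (k - 1))"
    by (intro power_increasing) auto
  then show "card (cocycles k V) \<le> 2 ^ (card V ^ (k - 1))"
    using card_image_le[OF fin, of edges] c unfolding cocycles_def by linarith
qed

lemma even_card_sym_diff: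
  assumes "finite X" "finite Y"
  shows "even (card (sym_diff X Y)) \<longleftrightarrow> (even (card X) \<longleftrightarrow> even (card Y))"
proof -
  have "card (sym_diff X Y) = card (X - Y) + card (Y - X)"
    using assms by (intro card_Un_disjoint) auto
  moreover have "card X = card (X \<inter> Y) + card (X - Y)" "card Y = card (X \<inter> Y) + card (Y - X)"
    using card_Int_Diff[OF assms(1), of Y] card_Int_Diff[OF assms(2), of X] by (simp_all add: Int_commute)
  ultimately have "card (sym_diff X Y) + 2 * card (X \<inter> Y) = card X + card Y" by simp
  then show ?thesis by presburger
qed

text \<open>Parities add under symmetric difference, and two hypergraphings of \<open>G\<close> have
  equal parity on every (k+1)-set; so their difference is even there, like the empty
  hypergraph.\<close>

lemma sym_diff_mem_cocycles:
  assumes H: "hypergraphing k H G" and H': "hypergraphing k H' G"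
  shows "sym_diff (edges H) (edges H') \<in> cocycles k (verts G)"
proof -
  let ?Z = "\<lparr>verts = verts G, edges = sym_diff (edges H) (edges H')\<rparr>"
  have vs: "verts H = verts G" "verts H' = verts G"
    using assms by (simp_all add: hypergraphing_verts)
  have "uniform k ?Z"
    using assms vs by (auto simp: hypergraphing_def uniform_def)
  moreover have "associated_kay_graph k ?Z =
      associated_kay_graph k \<lparr>verts = verts G, edges = {}\<rparr>"
  proof -
    have "even (card (edges_in ?Z S))" if S: "S \<in> nsets (verts G) (k + 1)" for S
    proof -
      have "edges_in ?Z S = sym_diff (edges_in H S) (edges_in H' S)"
        by (auto simp: edges_in_def)
      moreover have "finite S" using S by (simp add: nsets_iff)
      ultimately show ?thesis
        using hypergraphing_parity[OF H S] hypergraphing_parity[OF H' S]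
        by (auto simp: even_card_sym_diff finite_edges_in)
    qed
    then show ?thesis by (auto simp: associated_kay_graph_def edges_in_def)
  qed
  ultimately have "hypergraphing k ?Z (associated_kay_graph k \<lparr>verts = verts G, edges = {}\<rparr>)"
    by (simp add: hypergraphing_def)
  then show ?thesis unfolding cocycles_def by (intro image_eqI[of _ _ ?Z]) simp_all
qed

section \<open>Embeddings and pullbacks\<close>

text \<open>Embeddings of a uniform hypergraph are the injections with a prescribed pullback, so
  embedding counts become sizes of fibres.\<close>

definition pullback :: "nat \<Rightarrow> ('a \<Rightarrow> 'b) \<Rightarrow> 'a set \<Rightarrow> 'b hypergraph \<Rightarrow> 'a hypergraph" where
  "pullback k f V H = \<lparr>verts = V, edges = {e \<in> nsets V k. f ` e \<in> edges H}\<rparr>"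

definition injections :: "'a set \<Rightarrow> 'b set \<Rightarrow> ('a \<Rightarrow> 'b) set" where
  "injections V W = {f \<in> V \<rightarrow>\<^sub>E W. inj_on f V}"

lemma finite_injections: "finite V \<Longrightarrow> finite W \<Longrightarrow> finite (injections V W)"
  by (rule finite_subset[of _ "V \<rightarrow>\<^sub>E W"]) (auto simp: injections_def intro: finite_PiE)

lemma uniform_pullback: "uniform k (pullback k f V H)"
  by (auto simp: uniform_def pullback_def)

lemma embeddings_eq_pullback:
  assumes "uniform k A"
  shows "embeddings k A B = {f \<in> injections (verts A) (verts B). pullback k f (verts A) B = A}"
proof -
  have "pullback k f (verts A) B = A \<longleftrightarrow> (\<forall>e\<in>nsets (verts A) k. e \<in> edges A \<longleftrightarrow> f ` e \<in> edges B)" for f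
    using assms by (cases A) (auto simp: pullback_def uniform_def)
  then show ?thesis by (auto simp: embeddings_def injections_def)
qed

lemma card_edges_in_pullback:
  assumes "uniform k H" "S \<subseteq> V" "inj_on f V"
  shows "card (edges_in H (f ` S)) = card (edges_in (pullback k f V H) S)"
proof -
  have injS: "inj_on f S" using assms inj_on_subset by blast
  have "edges_in H (f ` S) = image f ` edges_in (pullback k f V H) S"
  proof (intro equalityI subsetI)
    fix e assume e: "e \<in> edges_in H (f ` S)"
    then obtain d where d: "d \<subseteq> S" "e = f ` d"
      by (auto simp: edges_in_def subset_image_iff)
    have i: "inj_on f d" using d injS inj_on_subset by blast
    have "finite e" "card e = k" using e uniform_edge[OF assms(1)] by (auto simp: edges_in_def)
    then have "finite d" "card d = k"
      using d i by (auto simp: finite_image_iff card_image)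
    then show "e \<in> image f ` edges_in (pullback k f V H) S"
      using d e assms(2) by (auto simp: edges_in_def pullback_def nsets_iff)
  qed (auto simp: edges_in_def pullback_def)
  moreover have "inj_on (image f) (edges_in (pullback k f V H) S)"
    by (rule inj_on_subset[OF inj_on_image_Pow[OF injS]]) (auto simp: edges_in_def)
  ultimately show ?thesis by (simp add: card_image)
qed

lemma pullback_associated:
  assumes "uniform k H" "f \<in> injections V (verts H)"
  shows "pullback (k + 1) f V (associated_kay_graph k H) =
    associated_kay_graph k (pullback k f V H)"
proof -
  have f: "inj_on f V" "f ` V \<subseteq> verts H"
    using assms(2) by (auto simp: injections_def)
  have "f ` S \<in> edges (associated_kay_graph k H) \<longleftrightarrow>
      S \<in> edges (associated_kay_graph k (pullback k f V H))" if S: "S \<in> nsets V (k + 1)" for S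
  proof -
    have "S \<subseteq> V" using S by (simp add: nsets_iff)
    then have "f ` S \<in> nsets (verts H) (k + 1)"
      using S f by (auto simp: nsets_iff card_image inj_on_subset)
    then show ?thesis
      using S card_edges_in_pullback[OF assms(1) \<open>S \<subseteq> V\<close> f(1)]
      by (auto simp: associated_kay_graph_def) (auto simp: pullback_def)
  qed
  then show ?thesis
    by (auto simp: pullback_def associated_kay_graph_def)
qed

lemma card_fibres:
  assumes "finite M" "finite Y"
  shows "(\<Sum>y\<in>Y. card {f \<in> M. g f = y}) = card {f \<in> M. g f \<in> Y}"
proof -
  have "card (\<Union>y\<in>Y. {f \<in> M. g f = y}) = (\<Sum>y\<in>Y. card {f \<in> M. g f = y})"
    using assms by (intro card_UN_disjoint) auto
  moreover have "(\<Union>y\<in>Y. {f \<in> M. g f = y}) = {f \<in> M. g f \<in> Y}" by auto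
  ultimately show ?thesis by simp
qed

text \<open>Every embedding of \<open>A\<close> pulls \<open>H\<close> back to exactly one
  hypergraphing of \<open>A\<close>.\<close>

lemma num_embeddings_kay_graph:
  assumes "kay_graph k A" "finite (verts A)" "k \<ge> 2" "uniform k H" "finite (verts H)"
  shows "num_embeddings (k + 1) A (associated_kay_graph k H) =
    (\<Sum>A' | hypergraphing k A' A. num_embeddings k A' H)"
proof -
  let ?M = "injections (verts A) (verts H)"
  let ?Y = "{A'. hypergraphing k A' A}"
  let ?g = "\<lambda>f. pullback k f (verts A) H"
  have fin: "finite ?Y"
    using card_hypergraphings[OF assms(1-3)] by (intro card_ge_0_finite) simp
  have "embeddings (k + 1) A (associated_kay_graph k H) =
      {f \<in> ?M. associated_kay_graph k (?g f) = A}"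
  proof -
    have "uniform (k + 1) A" using assms(1) by (simp add: kay_graph_def)
    moreover have "verts (associated_kay_graph k H) = verts H"
      by (simp add: associated_kay_graph_def)
    ultimately show ?thesis
      using pullback_associated[OF assms(4), of _ "verts A"]
      by (simp add: embeddings_eq_pullback cong: conj_cong)
  qed
  also have "\<dots> = {f \<in> ?M. ?g f \<in> ?Y}"
    by (auto simp: hypergraphing_def uniform_pullback)
  finally have "num_embeddings (k + 1) A (associated_kay_graph k H) = card {f \<in> ?M. ?g f \<in> ?Y}"
    by (simp add: num_embeddings_def)
  also have "\<dots> = (\<Sum>A'\<in>?Y. card {f \<in> ?M. ?g f = A'})"
    using card_fibres[of ?M ?Y ?g] fin finite_injections[OF assms(2,5)] by (simp only:)
  also have "\<dots> = (\<Sum>A'\<in>?Y. num_embeddings k A' H)"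
  proof (rule sum.cong)
    fix A' assume "A' \<in> ?Y"
    then have "uniform k A'" "verts A' = verts A"
      by (auto simp: hypergraphing_def associated_kay_graph_def)
    then show "card {f \<in> ?M. ?g f = A'} = num_embeddings k A' H"
      by (simp add: num_embeddings_def embeddings_eq_pullback)
  qed simp
  finally show ?thesis .
qed

text \<open>Every injection pulls \<open>H\<close> back to exactly one \<open>D\<close>. Averaging
  over \<open>D\<close> will bound the individual counts from below.\<close>

lemma sum_num_embeddings:
  assumes "finite V" "finite (verts H)"
  shows "(\<Sum>D\<in>Pow (nsets V k). num_embeddings k \<lparr>verts = V, edges = D\<rparr> H) =
    card (injections V (verts H))"
proof -
  let ?M = "injections V (verts H)"
  let ?g = "\<lambda>f. edges (pullback k f V H)"
  have "num_embeddings k \<lparr>verts = V, edges = D\<rparr> H = card {f \<in> ?M. ?g f = D}"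
    if "D \<in> Pow (nsets V k)" for D
  proof -
    have "uniform k \<lparr>verts = V, edges = D\<rparr>" using that by (simp add: uniform_def)
    then show ?thesis by (simp add: num_embeddings_def embeddings_eq_pullback pullback_def)
  qed
  then have "(\<Sum>D\<in>Pow (nsets V k). num_embeddings k \<lparr>verts = V, edges = D\<rparr> H) =
      card {f \<in> ?M. ?g f \<in> Pow (nsets V k)}"
    using card_fibres[of ?M "Pow (nsets V k)" ?g] assms
    by (simp add: finite_injections finite_imp_finite_nsets)
  also have "{f \<in> ?M. ?g f \<in> Pow (nsets V k)} = ?M"
    by (auto simp: pullback_def)
  finally show ?thesis .
qed

text \<open>Each factor \<open>n - i\<close> of the falling factorial is at least half of
  \<open>n\<close>.\<close>

lemma card_injections_ge:
  assumes "finite V" "finite W" "2 * card V \<le> card W"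
  shows "card W ^ card V \<le> 2 ^ card V * card (injections V W)"
proof -
  let ?n = "card W"
  have "card (injections V W) = (\<Prod>i = 0..<card V. ?n - i)"
    using card_inj_on_subset_funcset[OF assms(1,2), of V] by (simp add: injections_def)
  moreover have "(\<Prod>i = 0..<card V. ?n) \<le> (\<Prod>i = 0..<card V. 2 * (?n - i))"
    using assms(3) by (intro prod_mono) auto
  ultimately show ?thesis by (simp add: prod.distrib)
qed

section \<open>Small discrepancy\<close>

text \<open>For \<open>0 \<le> y \<le> 1\<close>, \<open>exp y\<close> is at most
  \<open>1 + y + y\<^sup>2\<close> and \<open>exp (- y)\<close> at most
  \<open>1 - y + y\<^sup>2\<close>; the linear terms cancel. The left side is even in
  \<open>x\<close>.\<close>

lemma exp_plus_exp_minus_le: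
  fixes x :: real
  assumes "\<bar>x\<bar> \<le> 1"
  shows "exp x + exp (- x) \<le> 2 * exp (x\<^sup>2)"
proof -
  have *: "exp y + exp (- y) \<le> 2 * exp (y\<^sup>2)" if y: "0 \<le> y" "y \<le> 1" for y :: real
  proof -
    have "exp (- y) \<le> 1 / (1 + y)"
      using exp_ge_add_one_self[of y] y by (simp add: exp_minus field_simps)
    also have "\<dots> \<le> 1 - y + y\<^sup>2"
    proof -
      have "(1 - y + y\<^sup>2) * (1 + y) = 1 + y ^ 3"
        by (simp add: algebra_simps power2_eq_square power3_eq_cube)
      moreover have "0 \<le> y ^ 3" using y by simp
      ultimately show ?thesis using y by (simp add: divide_le_eq)
    qed
    finally show ?thesis
      using exp_bound[OF y] exp_ge_add_one_self[of "y\<^sup>2"] by linarith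
  qed
  show ?thesis
    using *[of x] *[of "- x"] assms by (cases "x \<ge> 0") auto
qed

text \<open>Signs instead of indicators turn symmetric differences into products, so changing
  \<open>E\<close> by a cocycle only changes the signs of the weights.\<close>

definition edge_sign :: "'s set \<Rightarrow> 's \<Rightarrow> real" where
  "edge_sign E s = (if s \<in> E then - 1 else 1)"

lemma edge_sign_sym_diff: "edge_sign (sym_diff E Z) s = edge_sign E s * edge_sign Z s"
  by (auto simp: edge_sign_def)

text \<open>The moment generating function of a linear form in independent signs factorises; this is
  its unnormalised form over all subsets of \<open>K\<close>.\<close>

lemma sum_exp_edge_sign:
  assumes "finite K"
  shows "(\<Sum>E\<in>Pow K. exp (\<Sum>s\<in>K. edge_sign E s * u s)) = (\<Prod>s\<in>K. exp (- u s) + exp (u s))"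
proof -
  have "exp (\<Sum>s\<in>K. edge_sign E s * u s) = (\<Prod>s\<in>E. exp (- u s)) * (\<Prod>s\<in>K - E. exp (u s))"
    if "E \<in> Pow K" for E
  proof -
    have "exp (\<Sum>s\<in>K. edge_sign E s * u s) = (\<Prod>s\<in>K. exp (edge_sign E s * u s))"
      using assms by (rule exp_sum)
    also have "\<dots> = (\<Prod>s\<in>K - E. exp (edge_sign E s * u s)) * (\<Prod>s\<in>E. exp (edge_sign E s * u s))"
      using that assms by (intro prod.subset_diff) auto
    also have "\<dots> = (\<Prod>s\<in>K - E. exp (u s)) * (\<Prod>s\<in>E. exp (- u s))"
      by (simp add: edge_sign_def)
    finally show ?thesis by (simp add: mult.commute)
  qed
  then show ?thesis by (simp add: prod_add[OF assms])
qed

text \<open>Chernoff's bound, as a count of subsets: Markov's inequality for the exponential moment,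
  whose factors are bounded one by one because \<open>l * c \<le> 1\<close>.\<close>

lemma card_large_deviation:
  fixes c l t :: real
  assumes K: "finite K" and w: "\<And>s. s \<in> K \<Longrightarrow> \<bar>w s\<bar> \<le> c" and l: "0 \<le> l" "l * c \<le> 1"
  shows "real (card {E \<in> Pow K. t < (\<Sum>s\<in>K. edge_sign E s * w s)}) \<le>
    2 ^ card K * exp (l\<^sup>2 * c\<^sup>2 * card K - l * t)"
proof -
  let ?S = "\<lambda>E. \<Sum>s\<in>K. edge_sign E s * w s"
  let ?B = "{E \<in> Pow K. t < ?S E}"
  have "real (card ?B) * exp (l * t) = (\<Sum>E\<in>?B. exp (l * t))" by simp
  also have "\<dots> \<le> (\<Sum>E\<in>?B. exp (l * ?S E))"
    using l by (intro sum_mono) (auto intro: mult_left_mono)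
  also have "\<dots> \<le> (\<Sum>E\<in>Pow K. exp (l * ?S E))"
    using K by (intro sum_mono2) auto
  also have "\<dots> = (\<Sum>E\<in>Pow K. exp (\<Sum>s\<in>K. edge_sign E s * (l * w s)))"
    by (simp add: sum_distrib_left mult_ac)
  also have "\<dots> = (\<Prod>s\<in>K. exp (- (l * w s)) + exp (l * w s))"
    using K by (rule sum_exp_edge_sign)
  also have "\<dots> \<le> (\<Prod>s\<in>K. 2 * exp (l\<^sup>2 * c\<^sup>2))"
  proof (intro prod_mono conjI)
    fix s assume s: "s \<in> K"
    have b: "\<bar>l * w s\<bar> \<le> l * c"
      using mult_left_mono[OF w[OF s] l(1)] l(1) by (simp add: abs_mult)
    have "exp (l * w s) + exp (- (l * w s)) \<le> 2 * exp ((l * w s)\<^sup>2)"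
      using b l(2) by (intro exp_plus_exp_minus_le) simp
    also have "(l * w s)\<^sup>2 \<le> (l * c)\<^sup>2"
      using b by (meson abs_le_square_iff abs_ge_self order_trans)
    finally show "exp (- (l * w s)) + exp (l * w s) \<le> 2 * exp (l\<^sup>2 * c\<^sup>2)"
      by (simp add: power_mult_distrib)
  qed simp
  also have "\<dots> = 2 ^ card K * exp (l\<^sup>2 * c\<^sup>2 * card K)"
    by (simp add: power_mult_distrib exp_of_nat_mult[symmetric] mult_ac)
  finally show ?thesis
    by (simp add: exp_diff field_simps)
qed

text \<open>A union bound over \<open>I\<close>; the factor 2 pays for the upper and the lower tail,
  the latter being the upper tail of \<open>- w i\<close>.\<close>

lemma exists_small_discrepancy:
  fixes c l t :: real
  assumes K: "finite K" and I: "finite I"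
    and w: "\<And>i s. i \<in> I \<Longrightarrow> s \<in> K \<Longrightarrow> \<bar>w i s\<bar> \<le> c" and l: "0 \<le> l" "l * c \<le> 1"
    and small: "2 * real (card I) * exp (l\<^sup>2 * c\<^sup>2 * card K - l * t) < 1"
  shows "\<exists>E\<subseteq>K. \<forall>i\<in>I. \<bar>\<Sum>s\<in>K. edge_sign E s * w i s\<bar> \<le> t"
proof (rule ccontr)
  assume no: "\<not> ?thesis"
  define bad where "bad u = {E \<in> Pow K. t < (\<Sum>s\<in>K. edge_sign E s * u s)}" for u
  let ?x = "2 ^ card K * exp (l\<^sup>2 * c\<^sup>2 * card K - l * t)"
  have neg: "bad (\<lambda>s. - u s) = {E \<in> Pow K. t < - (\<Sum>s\<in>K. edge_sign E s * u s)}" for u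
    by (simp add: bad_def sum_negf)
  have "Pow K \<subseteq> (\<Union>i\<in>I. bad (w i) \<union> bad (\<lambda>s. - w i s))"
  proof
    fix E assume "E \<in> Pow K"
    then obtain i where "i \<in> I" "\<not> \<bar>\<Sum>s\<in>K. edge_sign E s * w i s\<bar> \<le> t"
      using no by blast
    then have "E \<in> bad (w i) \<union> bad (\<lambda>s. - w i s)"
      using \<open>E \<in> Pow K\<close> unfolding neg by (auto simp: bad_def)
    then show "E \<in> (\<Union>i\<in>I. bad (w i) \<union> bad (\<lambda>s. - w i s))"
      using \<open>i \<in> I\<close> by blast
  qed
  moreover have finb: "finite (bad u)" for u using K by (simp add: bad_def)
  ultimately have "card (Pow K) \<le> card (\<Union>i\<in>I. bad (w i) \<union> bad (\<lambda>s. - w i s))"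
    using I by (intro card_mono) auto
  also have "\<dots> \<le> (\<Sum>i\<in>I. card (bad (w i) \<union> bad (\<lambda>s. - w i s)))"
    using I by (rule card_UN_le)
  finally have "real (card (Pow K)) \<le> (\<Sum>i\<in>I. real (card (bad (w i) \<union> bad (\<lambda>s. - w i s))))"
    by (simp only: of_nat_sum[symmetric] of_nat_le_iff)
  also have "\<dots> \<le> (\<Sum>i\<in>I. 2 * ?x)"
  proof (rule sum_mono)
    fix i assume i: "i \<in> I"
    have "real (card (bad (w i))) \<le> ?x" "real (card (bad (\<lambda>s. - w i s))) \<le> ?x"
      unfolding bad_def using w[OF i] by (intro card_large_deviation[OF K _ l]; simp)+
    moreover have "card (bad (w i) \<union> bad (\<lambda>s. - w i s)) \<le> card (bad (w i)) + card (bad (\<lambda>s. - w i s))"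
      by (rule card_Un_le)
    ultimately show "real (card (bad (w i) \<union> bad (\<lambda>s. - w i s))) \<le> 2 * ?x"
      by linarith
  qed
  also have "\<dots> = 2 ^ card K * (2 * real (card I) * exp (l\<^sup>2 * c\<^sup>2 * card K - l * t))"
    by simp
  also have "\<dots> < 2 ^ card K * 1"
    using small by (intro mult_strict_left_mono) auto
  finally show False using K by (simp add: card_Pow)
qed

text \<open>A constraint family restricts a map on \<open>e\<close> only through its restrictions to proper
  subsets of \<open>e\<close>.\<close>

definition constraints :: "'a set \<Rightarrow> 'b set \<Rightarrow> ('a \<Rightarrow> ('a \<Rightarrow> 'b) set) set" where
  "constraints e V = (\<Pi>\<^sub>E i\<in>e. Pow ((e - {i}) \<rightarrow>\<^sub>E V))"

definition constrained :: "'a set \<Rightarrow> 'b set \<Rightarrow> ('a \<Rightarrow> ('a \<Rightarrow> 'b) set) \<Rightarrow> ('a \<Rightarrow> 'b) set" where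
  "constrained e V U = {y \<in> injections e V. \<forall>i\<in>e. restrict y (e - {i}) \<in> U i}"

definition constraint_weight ::
  "'a set \<Rightarrow> 'b set \<Rightarrow> ('a \<Rightarrow> ('a \<Rightarrow> 'b) set) \<Rightarrow> 'b set \<Rightarrow> real" where
  "constraint_weight e V U s = real (card {y \<in> constrained e V U. y ` e = s})"

text \<open>Each component concerns maps on one point fewer than \<open>e\<close>, hence the
  exponent of degree \<open>card e - 1\<close> in \<open>card V\<close>.\<close>

lemma card_constraints:
  assumes "finite e" "finite V"
  shows "finite (constraints e V)"
    "card (constraints e V) = 2 ^ (card e * card V ^ (card e - 1))"
proof -
  have "card (Pow ((e - {i}) \<rightarrow>\<^sub>E V)) = 2 ^ (card V ^ (card e - 1))" if "i \<in> e" for i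
    using that assms by (simp add: card_Pow finite_PiE card_PiE)
  then show "card (constraints e V) = 2 ^ (card e * card V ^ (card e - 1))"
    using assms by (simp add: constraints_def card_PiE power_mult[symmetric] mult.commute)
  show "finite (constraints e V)"
    using assms unfolding constraints_def by (intro finite_PiE) (auto intro: finite_PiE)
qed

text \<open>The maps counted are among all functions from \<open>e\<close> to
  \<open>s\<close>.\<close>

lemma constraint_weight_le:
  assumes "finite e" "s \<in> nsets V (card e)"
  shows "\<bar>constraint_weight e V U s\<bar> \<le> real (card e ^ card e)"
proof -
  have s: "finite s" "card s = card e" using assms by (auto simp: nsets_iff)
  have "{y \<in> constrained e V U. y ` e = s} \<subseteq> e \<rightarrow>\<^sub>E s"
    by (auto simp: constrained_def injections_def PiE_iff extensional_def)
  then have "card {y \<in> constrained e V U. y ` e = s} \<le> card (e \<rightarrow>\<^sub>E s)"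
    using assms s by (intro card_mono finite_PiE) auto
  also have "\<dots> = card e ^ card e"
    using assms s by (simp add: card_PiE)
  finally show ?thesis
    by (simp only: constraint_weight_def abs_of_nat of_nat_le_iff)
qed

text \<open>Grouping the maps by their image gives a linear form in the values of \<open>h\<close>,
  the shape required by the Chernoff bound.\<close>

lemma sum_constrained:
  fixes h :: "'b set \<Rightarrow> real"
  assumes "finite e" "finite V"
  shows "(\<Sum>y\<in>constrained e V U. h (y ` e)) =
    (\<Sum>s\<in>nsets V (card e). h s * constraint_weight e V U s)"
proof -
  have "(\<Sum>s\<in>nsets V (card e). \<Sum>y | y \<in> constrained e V U \<and> y ` e = s. h (y ` e)) =
      (\<Sum>y\<in>constrained e V U. h (y ` e))"
  proof (rule sum.group)
    show "finite (constrained e V U)"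
      using assms by (simp add: constrained_def finite_injections)
    show "(\<lambda>y. y ` e) ` constrained e V U \<subseteq> nsets V (card e)"
      using assms by (auto simp: constrained_def injections_def nsets_iff card_image)
  qed (use assms in \<open>simp add: finite_imp_finite_nsets\<close>)
  moreover have "(\<Sum>y | y \<in> constrained e V U \<and> y ` e = s. h (y ` e)) =
      h s * constraint_weight e V U s" for s
    by (simp add: constraint_weight_def mult.commute)
  ultimately show ?thesis by (simp only:)
qed

text \<open>The union bound runs over triples of a cocycle, a \<open>k\<close>-set and a constraint
  family. Including the cocycles makes the estimate hold for all hypergraphings of the kay-graph of
  \<open>E\<close>, not for \<open>E\<close> alone.\<close>

lemma exists_quasirandom:
  fixes a :: "'a set" and \<delta> :: real
  assumes a: "finite a" and k: "k \<ge> 2" and d: "0 < \<delta>" "\<delta> \<le> 1"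
  shows "\<exists>n E. m \<le> n \<and> E \<subseteq> nsets {..<n} k \<and>
    (\<forall>Z\<in>cocycles k {..<n}. \<forall>e\<in>nsets a k. \<forall>U\<in>constraints e {..<n}.
      \<bar>\<Sum>y\<in>constrained e {..<n} U. edge_sign (sym_diff E Z) (y ` e)\<bar> \<le> \<delta> * real (n ^ k))"
proof -
  define c where "c = real (k ^ k)"
  \<comment> \<open>\<open>l\<close> minimises \<open>l\<^sup>2 * c\<^sup>2 - l * \<delta>\<close>,
    and the minimum is \<open>- \<beta>\<close>.\<close>
  define \<beta> where "\<beta> = \<delta>\<^sup>2 / (4 * c\<^sup>2)"
  define l where "l = \<delta> / (2 * c\<^sup>2)"
  \<comment> \<open>\<open>q * n ^ (k - 1)\<close> will bound the binary logarithm of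
    \<open>2 * card I\<close>: 1 for the factor 2, \<open>n ^ (k - 1)\<close> for the cocycles,
    \<open>card a\<close> for the choice of \<open>e\<close> and \<open>k * n ^ (k - 1)\<close> for
    the constraints.\<close>
  define q where "q = card a + k + 2"
  have "1 \<le> k ^ k" using k by simp
  then have c: "1 \<le> c" unfolding c_def by (metis of_nat_1 of_nat_le_iff)
  have b: "0 < \<beta>" using c d by (simp add: \<beta>_def)
  have l: "0 \<le> l" "l * c \<le> 1"
  proof -
    show "0 \<le> l" using c d by (simp add: l_def)
    have "l * c = \<delta> / (2 * c)" using c by (simp add: l_def power2_eq_square field_simps)
    also have "\<dots> \<le> 1" using c d by (simp add: divide_le_eq)
    finally show "l * c \<le> 1" .
  qed
  obtain N where N: "real q / \<beta> < real N" using reals_Archimedean2 by blast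
  \<comment> \<open>Beyond \<open>q / \<beta>\<close> the Chernoff exponent
    \<open>\<beta> * n ^ k\<close> exceeds \<open>q * n ^ (k - 1)\<close>.\<close>
  define n where "n = max N (max m (max k 1))"
  have n: "m \<le> n" "k \<le> n" "1 \<le> n" "real q < \<beta> * real n"
  proof -
    have "real q / \<beta> < real n" using N unfolding n_def by linarith
    then show "real q < \<beta> * real n" using b by (simp add: field_simps)
  qed (auto simp: n_def)
  define p where "p = n ^ (k - 1)"
  have p: "1 \<le> p" "n ^ k = n * p"
    using n k power_Suc[of n "k - 1"] by (simp_all add: p_def)
  let ?V = "{..<n}" and ?K = "nsets {..<n} k"
  define I where "I = cocycles k ?V \<times> Sigma (nsets a k) (\<lambda>e. constraints e ?V)"
  \<comment> \<open>The sign of the cocycle goes into the weight, which thus does not depend on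
    \<open>E\<close>.\<close>
  define w :: "nat set set \<times> 'a set \<times> ('a \<Rightarrow> ('a \<Rightarrow> nat) set) \<Rightarrow> nat set \<Rightarrow> real"
    where "w = (\<lambda>(Z, e, U) s. edge_sign Z s * constraint_weight e ?V U s)"
  have cz: "card (cocycles k ?V) \<le> 2 ^ p" "finite (cocycles k ?V)"
    using card_cocycles_le[of ?V k] n k by (simp_all add: p_def)
  have ce: "finite (constraints e ?V)" "card (constraints e ?V) = 2 ^ (k * p)"
    if "e \<in> nsets a k" for e
    using card_constraints[of e ?V] that by (simp_all add: nsets_iff p_def)
  have finI: "finite I"
    unfolding I_def using cz ce a by (intro finite_cartesian_product finite_SigmaI)
      (simp_all add: finite_imp_finite_nsets)
  have "card I = card (cocycles k ?V) * (card (nsets a k) * 2 ^ (k * p))"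
    unfolding I_def using ce a
    by (simp add: card_cartesian_product card_SigmaI finite_imp_finite_nsets del: card_nsets)
  also have "\<dots> \<le> 2 ^ p * (2 ^ card a * 2 ^ (k * p))"
    using cz(1) binomial_le_pow2 by (intro mult_mono) simp_all
  finally have "2 * card I \<le> 2 * (2 ^ p * (2 ^ card a * 2 ^ (k * p)))" by simp
  also have "\<dots> = (2::nat) ^ (1 + p + card a + k * p)" by (simp add: power_add)
  also have "\<dots> \<le> 2 ^ (q * p)"
  proof (rule power_increasing)
    have "1 + card a \<le> (1 + card a) * p"
      using mult_le_mono2[OF p(1), of "1 + card a"] by (simp only: mult_1_right)
    then show "1 + p + card a + k * p \<le> q * p"
      by (simp add: q_def algebra_simps)
  qed simp
  finally have "2 * real (card I) \<le> 2 ^ (q * p)"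
    by (metis of_nat_le_iff of_nat_mult of_nat_numeral of_nat_power)
  also have "\<dots> \<le> exp (real (q * p))"
  proof -
    have "(2::real) ^ (q * p) \<le> exp 1 ^ (q * p)"
      using exp_ge_add_one_self[of 1] by (intro power_mono) auto
    then show ?thesis by (simp add: exp_of_nat_mult[symmetric])
  qed
  also have "\<dots> < exp (\<beta> * real (n ^ k))"
    using n(4) p by (simp add: mult.assoc[symmetric])
  finally have I: "2 * real (card I) < exp (\<beta> * real (n ^ k))" .
  have "card ?K \<le> n ^ k" using n by (simp add: binomial_le_pow)
  then have "l\<^sup>2 * c\<^sup>2 * card ?K - l * (\<delta> * real (n ^ k)) \<le>
      l\<^sup>2 * c\<^sup>2 * real (n ^ k) - l * (\<delta> * real (n ^ k))"
    by (intro diff_right_mono mult_left_mono) (simp_all del: card_nsets of_nat_power)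
  also have "\<dots> = - (\<beta> * real (n ^ k))"
    using c by (simp add: l_def \<beta>_def field_simps power2_eq_square)
  finally have "2 * real (card I) * exp (l\<^sup>2 * c\<^sup>2 * card ?K - l * (\<delta> * real (n ^ k))) \<le>
      2 * real (card I) * exp (- (\<beta> * real (n ^ k)))"
    by (intro mult_left_mono) simp_all
  also have "\<dots> < 1"
    using I by (simp add: exp_minus field_simps)
  finally have small: "2 * real (card I) * exp (l\<^sup>2 * c\<^sup>2 * card ?K - l * (\<delta> * real (n ^ k))) < 1" .
  have wc: "\<bar>w i s\<bar> \<le> c" if "i \<in> I" "s \<in> ?K" for i s
  proof -
    obtain Z e U where i: "i = (Z, e, U)" "e \<in> nsets a k"
      using \<open>i \<in> I\<close> by (auto simp: I_def)
    then have "\<bar>w i s\<bar> = \<bar>constraint_weight e ?V U s\<bar>"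
      by (simp add: w_def abs_mult edge_sign_def)
    then show ?thesis
      using constraint_weight_le[of e s ?V U] i that by (simp add: c_def nsets_iff)
  qed
  have finK: "finite ?K" by (simp add: finite_imp_finite_nsets)
  have "\<exists>E\<subseteq>?K. \<forall>i\<in>I. \<bar>\<Sum>s\<in>?K. edge_sign E s * w i s\<bar> \<le> \<delta> * real (n ^ k)"
    using wc by (intro exists_small_discrepancy[where w = w, OF finK finI _ l small])
  then obtain E where E: "E \<subseteq> ?K"
    and disc: "\<And>i. i \<in> I \<Longrightarrow> \<bar>\<Sum>s\<in>?K. edge_sign E s * w i s\<bar> \<le> \<delta> * real (n ^ k)"
    by blast
  have "\<bar>\<Sum>y\<in>constrained e ?V U. edge_sign (sym_diff E Z) (y ` e)\<bar> \<le> \<delta> * real (n ^ k)"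
    if "Z \<in> cocycles k ?V" "e \<in> nsets a k" "U \<in> constraints e ?V" for Z e U
  proof -
    have "finite e" "card e = k" using that by (auto simp: nsets_iff)
    then have "(\<Sum>y\<in>constrained e ?V U. edge_sign (sym_diff E Z) (y ` e)) =
        (\<Sum>s\<in>?K. edge_sign E s * w (Z, e, U) s)"
      using sum_constrained[of e ?V "edge_sign (sym_diff E Z)" U]
      by (simp add: w_def edge_sign_sym_diff mult.assoc)
    then show ?thesis using disc[of "(Z, e, U)"] that by (simp add: I_def)
  qed
  then show ?thesis using n(1) E by blast
qed

section \<open>Switching a hyperedge\<close>

lemma embeddings_record:
  "embeddings k \<lparr>verts = a, edges = D\<rparr> H =
    {f \<in> injections a (verts H). \<forall>e\<in>nsets a k. e \<in> D \<longleftrightarrow> f ` e \<in> edges H}"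
  by (auto simp: embeddings_def injections_def)

text \<open>Two points with the same value either form \<open>e\<close> or both survive the removal
  of some point of \<open>e\<close>. So, given injectivity on \<open>e\<close>, the rest is tested
  by conditions that each ignore a point of \<open>e\<close>.\<close>

lemma injective_embedding_local:
  assumes "k \<ge> 2" "e \<in> nsets a k" "inj_on f e" "\<And>i. i \<in> e \<Longrightarrow> inj_on f (a - {i})"
  shows "inj_on f a"
proof (rule inj_onI, rule ccontr)
  fix x y assume xy: "x \<in> a" "y \<in> a" "f x = f y" "x \<noteq> y"
  have e: "finite e" "card e = k" using assms by (auto simp: nsets_iff)
  show False
  proof (cases "e \<subseteq> {x, y}")
    case True
    moreover have "card {x, y} = 2" using xy by simp
    ultimately have "e = {x, y}"
      using e assms(1) by (intro card_seteq) auto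
    then show False using assms(3) xy by (auto simp: inj_on_def)
  next
    case False
    then obtain i where "i \<in> e" "i \<noteq> x" "i \<noteq> y" by blast
    then show False using assms(4)[of i] xy by (auto simp: inj_on_def)
  qed
qed

text \<open>The two counts differ only in the requirement at \<open>e\<close>, so their difference
  is a signed sum. For each placement of the points outside \<open>e\<close>, the remaining
  requirements form a constraint family on \<open>e\<close>; there are
  \<open>card (verts H) ^ (card a - k)\<close> placements.\<close>

lemma card_switch_le:
  fixes a :: "'a set" and H :: "'b hypergraph" and t :: real
  assumes a: "finite a" and V: "finite (verts H)" and k: "k \<ge> 2"
    and e: "e \<in> nsets a k" "e \<notin> D"
    and quasi: "\<And>U. U \<in> constraints e (verts H) \<Longrightarrow>
      \<bar>\<Sum>y\<in>constrained e (verts H) U. edge_sign (edges H) (y ` e)\<bar> \<le> t"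
  shows "\<bar>real (num_embeddings k \<lparr>verts = a, edges = insert e D\<rparr> H) -
      real (num_embeddings k \<lparr>verts = a, edges = D\<rparr> H)\<bar> \<le> real (card (verts H) ^ (card a - k)) * t"
proof -
  let ?V = "verts H"
  define M where "M = {f \<in> injections a ?V. \<forall>d\<in>nsets a k - {e}. d \<in> D \<longleftrightarrow> f ` d \<in> edges H}"
  let ?h = "\<lambda>s. edge_sign (edges H) s"
  have finM: "finite M" using a V by (simp add: M_def finite_injections)
  have ea: "e \<subseteq> a" "finite e" "card e = k" using e by (auto simp: nsets_iff)
  have "num_embeddings k \<lparr>verts = a, edges = insert e D\<rparr> H = card {f \<in> M. f ` e \<in> edges H}"
    unfolding num_embeddings_def embeddings_record M_def
    using e by (intro arg_cong[where f = card]) auto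
  moreover have "num_embeddings k \<lparr>verts = a, edges = D\<rparr> H = card {f \<in> M. f ` e \<notin> edges H}"
    unfolding num_embeddings_def embeddings_record M_def
    using e by (intro arg_cong[where f = card]) auto
  moreover have "(\<Sum>f\<in>M. ?h (f ` e)) =
      real (card {f \<in> M. f ` e \<notin> edges H}) - real (card {f \<in> M. f ` e \<in> edges H})"
    using finM by (simp add: edge_sign_def sum.If_cases Int_def Collect_neg_eq[symmetric])
  ultimately have diff: "real (num_embeddings k \<lparr>verts = a, edges = insert e D\<rparr> H) -
      real (num_embeddings k \<lparr>verts = a, edges = D\<rparr> H) = - (\<Sum>f\<in>M. ?h (f ` e))"
    by simp
  \<comment> \<open>The requirements that do not involve the value at \<open>i\<close>.\<close>
  define ok where "ok i f \<longleftrightarrow> inj_on f (a - {i}) \<and>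
      (\<forall>d\<in>nsets a k - {e}. i \<notin> d \<longrightarrow> (d \<in> D \<longleftrightarrow> f ` d \<in> edges H))" for i and f :: "'a \<Rightarrow> 'b"
  have ok_cong: "ok i f \<longleftrightarrow> ok i f'" if "\<And>x. x \<in> a \<Longrightarrow> x \<noteq> i \<Longrightarrow> f x = f' x" for i f f'
  proof -
    have "inj_on f (a - {i}) \<longleftrightarrow> inj_on f' (a - {i})"
      using that by (intro inj_on_cong) auto
    moreover have "f ` d = f' ` d" if "d \<in> nsets a k" "i \<notin> d" for d
      using that \<open>\<And>x. x \<in> a \<Longrightarrow> x \<noteq> i \<Longrightarrow> f x = f' x\<close> by (intro image_cong) (auto simp: nsets_iff)
    ultimately show ?thesis by (auto simp: ok_def)
  qed
  define join where "join y g = (\<lambda>x\<in>a. if x \<in> e then y x else g x)" for y g :: "'a \<Rightarrow> 'b"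
  \<comment> \<open>At \<open>i\<close> the glued map has the default value \<open>undefined\<close>
    of \<open>p\<close>, which \<open>ok i\<close> ignores.\<close>
  define U where "U g = (\<lambda>i\<in>e. {p \<in> (e - {i}) \<rightarrow>\<^sub>E ?V. ok i (join p g)})" for g
  have fibre: "\<bar>\<Sum>f | f \<in> M \<and> restrict f (a - e) = g. ?h (f ` e)\<bar> \<le> t"
    if g: "g \<in> (a - e) \<rightarrow>\<^sub>E ?V" for g
  proof -
    have join_ok: "ok i (join (restrict y (e - {i})) g) \<longleftrightarrow> ok i (join y g)" if "i \<in> e" for i y
      by (rule ok_cong) (auto simp: join_def)
    have "(\<Sum>f | f \<in> M \<and> restrict f (a - e) = g. ?h (f ` e)) =
        (\<Sum>y\<in>constrained e ?V (U g). ?h (y ` e))"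
    proof (rule sum.reindex_bij_witness[where i = "\<lambda>y. join y g" and j = "\<lambda>f. restrict f e"])
      fix f assume "f \<in> {f. f \<in> M \<and> restrict f (a - e) = g}"
      then have f: "f \<in> a \<rightarrow>\<^sub>E ?V" "inj_on f a" "restrict f (a - e) = g"
        "\<And>d. d \<in> nsets a k - {e} \<Longrightarrow> d \<in> D \<longleftrightarrow> f ` d \<in> edges H"
        by (auto simp: M_def injections_def)
      have gx: "g x = f x" if "x \<in> a" "x \<notin> e" for x
        using that f(3)[symmetric] by simp
      show join: "join (restrict f e) g = f"
      proof
        fix x show "join (restrict f e) g x = f x"
          using gx PiE_arb[OF f(1)] by (auto simp: join_def restrict_def)
      qed
      have "restrict (restrict f e) (e - {i}) \<in> U g i" if i: "i \<in> e" for i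
      proof -
        have "ok i f" using f(2,4) by (auto simp: ok_def intro: inj_on_subset)
        then have "ok i (join (restrict (restrict f e) (e - {i})) g)"
          by (simp only: join_ok[OF i] join)
        moreover have "restrict (restrict f e) (e - {i}) \<in> (e - {i}) \<rightarrow>\<^sub>E ?V"
          using f(1) ea unfolding restrict_def by (intro PiE_I) auto
        ultimately show ?thesis using i by (simp add: U_def)
      qed
      moreover have "restrict f e \<in> injections e ?V"
        using f(1,2) ea by (auto simp: injections_def intro: inj_on_subset)
      ultimately show "restrict f e \<in> constrained e ?V (U g)"
        by (simp add: constrained_def)
      show "?h (restrict f e ` e) = ?h (f ` e)" by simp
    next
      fix y assume "y \<in> constrained e ?V (U g)"
      then have y: "y \<in> e \<rightarrow>\<^sub>E ?V" "inj_on y e"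
        and ok: "\<And>i. i \<in> e \<Longrightarrow> ok i (join y g)"
        using join_ok by (auto simp: constrained_def injections_def U_def)
      show "restrict (join y g) e = y"
        using ea PiE_arb[OF y(1)] by (auto simp: join_def restrict_def fun_eq_iff)
      have "join y g \<in> a \<rightarrow>\<^sub>E ?V" using y(1) g by (auto simp: join_def)
      moreover have "inj_on (join y g) a"
      proof (rule injective_embedding_local[OF k e(1)])
        show "inj_on (join y g) e"
          using y(2) ea by (auto simp: inj_on_def join_def)
      qed (use ok in \<open>auto simp: ok_def\<close>)
      moreover have "d \<in> D \<longleftrightarrow> join y g ` d \<in> edges H" if d: "d \<in> nsets a k - {e}" for d
      proof -
        \<comment> \<open>A \<open>k\<close>-set other than \<open>e\<close> misses a point
          \<open>i\<close> of \<open>e\<close>, so its requirement is part of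
          \<open>ok i\<close>.\<close>
        have "\<not> e \<subseteq> d" using d ea card_subset_eq[of d e] by (auto simp: nsets_iff)
        then obtain i where "i \<in> e" "i \<notin> d" by blast
        then show ?thesis using ok d by (auto simp: ok_def)
      qed
      ultimately have "join y g \<in> M" by (auto simp: M_def injections_def)
      moreover have "restrict (join y g) (a - e) = g"
        using PiE_arb[OF g] by (auto simp: join_def restrict_def fun_eq_iff)
      ultimately show "join y g \<in> {f. f \<in> M \<and> restrict f (a - e) = g}" by simp
    qed
    moreover have "U g \<in> constraints e ?V"
      by (auto simp: U_def constraints_def)
    ultimately show ?thesis using quasi by simp
  qed
  let ?G = "(a - e) \<rightarrow>\<^sub>E ?V"
  have "(\<Sum>f\<in>M. ?h (f ` e)) = (\<Sum>g\<in>?G. \<Sum>f | f \<in> M \<and> restrict f (a - e) = g. ?h (f ` e))"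
  proof (rule sum.group[symmetric, OF finM])
    show "finite ?G" using a V by (intro finite_PiE) auto
    show "(\<lambda>f. restrict f (a - e)) ` M \<subseteq> ?G" by (auto simp: M_def injections_def)
  qed
  then have "\<bar>\<Sum>f\<in>M. ?h (f ` e)\<bar> \<le> (\<Sum>g\<in>?G. t)"
    using order_trans[OF sum_abs sum_mono[OF fibre]] by simp
  also have "\<dots> = real (card ?V ^ (card a - k)) * t"
    using a ea by (simp add: card_PiE card_Diff_subset)
  finally show ?thesis unfolding diff by simp
qed

text \<open>Both counts are compared with that of the empty hypergraph, inserting one hyperedge at a
  time; the two comparisons give the factor 2.\<close>

lemma num_embeddings_diff_le:
  fixes a :: "'a set" and H :: "'b hypergraph" and t :: real
  assumes a: "finite a" and V: "finite (verts H)" and k: "k \<ge> 2" and t: "0 \<le> t"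
    and quasi: "\<And>e U. e \<in> nsets a k \<Longrightarrow> U \<in> constraints e (verts H) \<Longrightarrow>
      \<bar>\<Sum>y\<in>constrained e (verts H) U. edge_sign (edges H) (y ` e)\<bar> \<le> t"
    and D: "D \<subseteq> nsets a k" "D' \<subseteq> nsets a k"
  shows "\<bar>real (num_embeddings k \<lparr>verts = a, edges = D\<rparr> H) -
      real (num_embeddings k \<lparr>verts = a, edges = D'\<rparr> H)\<bar> \<le>
    2 * real (card (nsets a k)) * (real (card (verts H) ^ (card a - k)) * t)"
proof -
  let ?N = "\<lambda>D. real (num_embeddings k \<lparr>verts = a, edges = D\<rparr> H)"
  let ?x = "real (card (verts H) ^ (card a - k)) * t"
  have fin: "finite (nsets a k)" using a by (rule finite_imp_finite_nsets)
  have *: "\<bar>?N D - ?N {}\<bar> \<le> real (card (nsets a k)) * ?x" if "D \<subseteq> nsets a k" for D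
  proof -
    have "finite D" using that fin finite_subset by blast
    then have "\<bar>?N D - ?N {}\<bar> \<le> real (card D) * ?x" using that
    proof (induction D)
      case (insert e D)
      then have "\<bar>?N (insert e D) - ?N D\<bar> \<le> ?x"
        using a V k quasi by (intro card_switch_le) auto
      moreover have "\<bar>?N D - ?N {}\<bar> \<le> real (card D) * ?x" using insert by simp
      moreover have "real (card (insert e D)) * ?x = real (card D) * ?x + ?x"
        using insert by (simp add: algebra_simps)
      ultimately show ?case by linarith
    qed simp
    also have "\<dots> \<le> real (card (nsets a k)) * ?x"
      using that fin t by (intro mult_right_mono) (simp_all add: card_mono del: card_nsets)
    finally show ?thesis .
  qed
  show ?thesis using *[OF D(1)] *[OF D(2)] by linarith
qed

text \<open>Since the counts are within \<open>\<eta>\<close> of each other, each is within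
  \<open>\<eta>\<close> of the average over the hypergraphings of \<open>A\<close>, which is
  \<open>rho k A\<close> times the total. The error is then divided by a total of at least
  \<open>\<gamma>\<close>.\<close>

lemma num_embeddings_almost_uniform:
  fixes A :: "'a hypergraph" and H :: "'b hypergraph" and \<eta> \<gamma> \<epsilon> :: real
  assumes A: "kay_graph k A" "finite (verts A)" and H: "uniform k H" "finite (verts H)"
    and k: "k \<ge> 2"
    and close: "\<And>D D'. D \<subseteq> nsets (verts A) k \<Longrightarrow> D' \<subseteq> nsets (verts A) k \<Longrightarrow>
      \<bar>real (num_embeddings k \<lparr>verts = verts A, edges = D\<rparr> H) -
        real (num_embeddings k \<lparr>verts = verts A, edges = D'\<rparr> H)\<bar> \<le> \<eta>"
    and large: "2 ^ card (nsets (verts A) k) * (\<eta> + \<gamma>) \<le> real (card (injections (verts A) (verts H)))"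
    and pos: "0 < \<gamma>" and small: "\<eta> \<le> \<epsilon> * \<gamma>"
  shows "0 < num_embeddings (k + 1) A (associated_kay_graph k H)"
    "\<And>A'. hypergraphing k A' A \<Longrightarrow>
      \<bar>real (num_embeddings k A' H) / real (num_embeddings (k + 1) A (associated_kay_graph k H)) -
        rho k A\<bar> \<le> \<epsilon>"
proof -
  let ?a = "verts A"
  let ?K = "nsets ?a k"
  let ?N = "\<lambda>D. real (num_embeddings k \<lparr>verts = ?a, edges = D\<rparr> H)"
  let ?Y = "{A'. hypergraphing k A' A}"
  let ?T = "real (num_embeddings (k + 1) A (associated_kay_graph k H))"
  define m where "m = real (card ?Y)"
  have m: "m = 2 ^ ((card ?a - 1) choose (k - 1))"
    using card_hypergraphings[OF A k] by (simp add: m_def)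
  then have m1: "1 \<le> m" by simp
  have rho: "rho k A = 1 / m" by (simp add: rho_def m)
  have finK: "finite ?K" using A(2) by (rule finite_imp_finite_nsets)
  have expand: "\<exists>D\<subseteq>?K. A' = \<lparr>verts = ?a, edges = D\<rparr>" if "hypergraphing k A' A" for A'
    using that hypergraphing_verts[OF that]
    by (intro exI[of _ "edges A'"]) (auto simp: hypergraphing_def uniform_def)
  \<comment> \<open>Averaging over all \<open>k\<close>-uniform hypergraphs on the vertices of
    \<open>A\<close>: a count below \<open>\<gamma>\<close> would keep every count below
    \<open>\<eta> + \<gamma>\<close>, too few for the number of injections.\<close>
  have lower: "\<gamma> \<le> ?N D" if D: "D \<subseteq> ?K" for D
  proof -
    have "real (card (injections ?a (verts H))) = (\<Sum>D'\<in>Pow ?K. ?N D')"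
      using sum_num_embeddings[OF A(2) H(2), of k] by (metis of_nat_sum)
    also have "\<dots> \<le> (\<Sum>D'\<in>Pow ?K. ?N D + \<eta>)"
    proof (rule sum_mono)
      fix D' assume "D' \<in> Pow ?K"
      then show "?N D' \<le> ?N D + \<eta>" using close[of D' D] D by (simp add: abs_le_iff)
    qed
    also have "\<dots> = 2 ^ card ?K * (?N D + \<eta>)"
      using finK by (simp add: card_Pow del: card_nsets)
    finally have "2 ^ card ?K * (\<eta> + \<gamma>) \<le> 2 ^ card ?K * (?N D + \<eta>)" using large by linarith
    then have "\<eta> + \<gamma> \<le> ?N D + \<eta>"
      by (subst (asm) mult_le_cancel_left_pos) simp_all
    then show ?thesis by simp
  qed
  have T: "?T = (\<Sum>A'\<in>?Y. real (num_embeddings k A' H))"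
    using num_embeddings_kay_graph[OF A k H] by (metis of_nat_sum)
  have "(\<Sum>A'\<in>?Y. \<gamma>) \<le> ?T"
    unfolding T using expand lower by (intro sum_mono) fastforce
  then have "m * \<gamma> \<le> ?T" by (simp add: m_def)
  moreover have mg: "\<gamma> \<le> m * \<gamma>" using m1 pos by simp
  ultimately have Tpos: "0 < ?T" and Tge: "\<gamma> \<le> ?T" using pos by linarith+
  then show "0 < num_embeddings (k + 1) A (associated_kay_graph k H)" by simp
  fix A' assume A': "hypergraphing k A' A"
  let ?x = "real (num_embeddings k A' H)"
  have "\<bar>?x - real (num_embeddings k A'' H)\<bar> \<le> \<eta>" if "hypergraphing k A'' A" for A''
    using expand[OF A'] expand[OF that] close by blast
  then have "(\<Sum>A''\<in>?Y. \<bar>?x - real (num_embeddings k A'' H)\<bar>) \<le> (\<Sum>A''\<in>?Y. \<eta>)"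
    by (intro sum_mono) simp
  moreover have "\<bar>\<Sum>A''\<in>?Y. ?x - real (num_embeddings k A'' H)\<bar> \<le>
      (\<Sum>A''\<in>?Y. \<bar>?x - real (num_embeddings k A'' H)\<bar>)"
    by (rule sum_abs)
  ultimately have close': "\<bar>m * ?x - ?T\<bar> \<le> m * \<eta>"
    unfolding T by (simp add: sum_subtractf m_def)
  have "?x / ?T - 1 / m = (m * ?x - ?T) / (m * ?T)"
    using m1 Tpos by (simp add: divide_simps)
  then have "\<bar>?x / ?T - 1 / m\<bar> = \<bar>m * ?x - ?T\<bar> / (m * ?T)"
    using m1 Tpos by simp
  also have "\<dots> \<le> (m * \<eta>) / (m * ?T)"
    using close' m1 Tpos by (intro divide_right_mono) auto
  also have "\<dots> = \<eta> / ?T" using m1 by simp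
  also have "\<dots> \<le> \<epsilon>"
  proof -
    \<comment> \<open>\<open>\<eta>\<close> bounds an absolute value and is therefore
      nonnegative.\<close>
    have "0 \<le> \<epsilon> * \<gamma>" using small close[of "{}" "{}"] by simp
    then have "0 \<le> \<epsilon>" using pos by (simp add: zero_le_mult_iff)
    then have "\<epsilon> * \<gamma> \<le> \<epsilon> * ?T" using Tge by (rule mult_left_mono[rotated])
    then show ?thesis using small Tpos by (simp add: divide_le_eq)
  qed
  finally show "\<bar>?x / ?T - rho k A\<bar> \<le> \<epsilon>" by (simp add: rho)
qed

section \<open>Choice of the parameters and conclusion\<close>

theorem theorem3p34:
  fixes k :: nat and A :: "'a hypergraph" and \<epsilon> :: real
  assumes "k \<ge> 2"
    and "A \<in> finite_kay_graphs k"
    and "\<epsilon> > 0"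
  shows "\<exists>B :: nat hypergraph. B \<in> finite_kay_graphs k \<and> embeddings (k + 1) A B \<noteq> {} \<and>
    (\<forall>A' B'. hypergraphing k A' A \<longrightarrow> hypergraphing k B' B \<longrightarrow>
       \<bar>real (num_embeddings k A' B') / real (num_embeddings (k + 1) A B) - rho k A\<bar> \<le> \<epsilon>)"
proof -
  let ?a = "verts A"
  define l where "l = card ?a"
  define q where "q = card (nsets ?a k)"
  \<comment> \<open>\<open>2 ^ l\<close> is lost in passing from all maps to injections, and
    \<open>2 ^ q\<close> is the number of hypergraphs averaged over.\<close>
  define \<tau> where "\<tau> = (2::real) ^ (l + q)"
  \<comment> \<open>Chosen so that \<open>\<eta> \<le> min 1 \<epsilon> * \<gamma>\<close> below:
    the 1 yields \<open>\<eta> \<le> \<gamma>\<close>, the \<open>\<epsilon>\<close> the final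
    error. Adding 1 to \<open>2 * real q\<close> keeps the denominator positive when
    \<open>q = 0\<close>.\<close>
  define \<delta> where "\<delta> = min 1 \<epsilon> / (2 * \<tau> * (2 * real q + 1))"
  have A: "kay_graph k A" "finite ?a" using assms(2) by (auto simp: finite_kay_graphs_def)
  have \<tau>: "1 \<le> \<tau>" by (simp add: \<tau>_def)
  have dpos: "0 < \<delta>" using assms(3) \<tau> by (simp add: \<delta>_def)
  have dq: "2 * real q * \<delta> \<le> min 1 \<epsilon> / (2 * \<tau>)"
  proof -
    have "2 * real q + 1 \<noteq> 0" by linarith
    then have "(2 * real q + 1) * \<delta> = min 1 \<epsilon> / (2 * \<tau>)"
      unfolding \<delta>_def times_divide_eq_right mult.commute[of "2 * real q + 1"]
      by (rule nonzero_mult_divide_mult_cancel_right)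
    then show ?thesis using dpos by (simp add: algebra_simps)
  qed
  have d1: "\<delta> \<le> 1"
  proof -
    have "1 * 1 \<le> (2 * \<tau>) * (2 * real q + 1)" using \<tau> by (intro mult_mono) auto
    then show ?thesis using \<tau> by (simp add: \<delta>_def divide_le_eq)
  qed
  obtain n E where n: "max 1 (2 * l) \<le> n" and E: "E \<subseteq> nsets {..<n} k"
    and quasi: "\<And>Z e U. Z \<in> cocycles k {..<n} \<Longrightarrow> e \<in> nsets ?a k \<Longrightarrow> U \<in> constraints e {..<n} \<Longrightarrow>
      \<bar>\<Sum>y\<in>constrained e {..<n} U. edge_sign (sym_diff E Z) (y ` e)\<bar> \<le> \<delta> * real (n ^ k)"
    using exists_quasirandom[OF A(2) assms(1) dpos d1, of "max 1 (2 * l)"] by blast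
  let ?H = "\<lparr>verts = {..<n}, edges = E\<rparr>"
  define B where "B = associated_kay_graph k ?H"
  have uH: "uniform k ?H" using E by (simp add: uniform_def)
  have vB: "verts B = {..<n}" by (simp add: B_def associated_kay_graph_def)
  have HB: "hypergraphing k ?H B" using uH by (simp add: hypergraphing_def B_def)
  define \<eta> where "\<eta> = 2 * real q * \<delta> * real (n ^ l)"
  define \<gamma> where "\<gamma> = real (n ^ l) / (2 * \<tau>)"
  have npos: "0 < real (n ^ l)" using n by simp
  have g: "0 < \<gamma>" using npos \<tau> by (simp add: \<gamma>_def)
  have eg: "\<eta> \<le> min 1 \<epsilon> * \<gamma>"
    using mult_right_mono[OF dq, of "real (n ^ l)"] npos by (simp add: \<eta>_def \<gamma>_def)
  have "min 1 \<epsilon> * \<gamma> \<le> 1 * \<gamma>" "min 1 \<epsilon> * \<gamma> \<le> \<epsilon> * \<gamma>"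
    using g by (intro mult_right_mono; simp)+
  then have eg': "\<eta> \<le> \<gamma>" "\<eta> \<le> \<epsilon> * \<gamma>" using eg by linarith+
  have large: "2 ^ q * (\<eta> + \<gamma>) \<le> real (card (injections ?a {..<n}))"
  proof -
    have "2 ^ q * (\<eta> + \<gamma>) \<le> 2 ^ q * (2 * \<gamma>)" using eg' by simp
    also have "\<dots> = real (n ^ l) / 2 ^ l"
      using \<tau> by (simp add: \<gamma>_def \<tau>_def power_add)
    also have "\<dots> \<le> real (card (injections ?a {..<n}))"
    proof -
      have "n ^ l \<le> 2 ^ l * card (injections ?a {..<n})"
        using card_injections_ge[of ?a "{..<n}"] A(2) n by (simp add: l_def)
      then have "real (n ^ l) \<le> real (2 ^ l * card (injections ?a {..<n}))"
        by (simp only: of_nat_le_iff)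
      then show ?thesis by (simp add: divide_le_eq mult.commute)
    qed
    finally show ?thesis .
  qed
  have main: "0 < num_embeddings (k + 1) A B"
      "hypergraphing k A' A \<Longrightarrow>
        \<bar>real (num_embeddings k A' B') / real (num_embeddings (k + 1) A B) - rho k A\<bar> \<le> \<epsilon>"
    if B': "hypergraphing k B' B" for A' B'
  proof -
    have vB': "verts B' = {..<n}" using hypergraphing_verts[OF B'] vB by simp
    have uB': "uniform k B'" and assB': "associated_kay_graph k B' = B"
      using B' by (auto simp: hypergraphing_def)
    \<comment> \<open>Every hypergraphing of \<open>B\<close> is \<open>E\<close> shifted by a
      cocycle, so the estimate for that cocycle is the one for \<open>edges B'\<close>.\<close>
    define Z where "Z = sym_diff E (edges B')"
    have "Z \<in> cocycles k {..<n}"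
      using sym_diff_mem_cocycles[OF HB B'] vB by (simp add: Z_def)
    moreover have "sym_diff E Z = edges B'" by (auto simp: Z_def)
    ultimately have qB': "\<bar>\<Sum>y\<in>constrained e (verts B') U. edge_sign (edges B') (y ` e)\<bar> \<le> \<delta> * real (n ^ k)"
      if "e \<in> nsets ?a k" "U \<in> constraints e (verts B')" for e U
      using quasi[of Z e U] that vB' by simp
    have close: "\<bar>real (num_embeddings k \<lparr>verts = ?a, edges = D\<rparr> B') -
        real (num_embeddings k \<lparr>verts = ?a, edges = D'\<rparr> B')\<bar> \<le> \<eta>"
      if "D \<subseteq> nsets ?a k" "D' \<subseteq> nsets ?a k" for D D'
    proof -
      have "\<bar>real (num_embeddings k \<lparr>verts = ?a, edges = D\<rparr> B') -
          real (num_embeddings k \<lparr>verts = ?a, edges = D'\<rparr> B')\<bar> \<le>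
          2 * real q * (real (n ^ (l - k)) * (\<delta> * real (n ^ k)))"
        using num_embeddings_diff_le[of ?a B' k "\<delta> * real (n ^ k)" D D'] A(2) assms(1) dpos qB' that
        by (simp add: vB' q_def l_def del: card_nsets)
      also have "\<dots> = \<eta>"
      proof (cases "k \<le> l")
        case True
        then have "n ^ (l - k) * n ^ k = n ^ l" by (simp add: power_add[symmetric])
        then have "real (n ^ (l - k)) * real (n ^ k) = real (n ^ l)" by (metis of_nat_mult)
        then show ?thesis by (simp add: \<eta>_def mult_ac)
      next
        \<comment> \<open>Here \<open>l - k\<close> truncates to 0 and the powers of
          \<open>n\<close> do not combine to \<open>n ^ l\<close>, but there are no
          \<open>k\<close>-sets and both sides vanish.\<close>
        case False
        then have "q = 0" by (simp add: q_def l_def binomial_eq_0)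
        then show ?thesis by (simp add: \<eta>_def)
      qed
      finally show ?thesis .
    qed
    have large': "2 ^ card (nsets ?a k) * (\<eta> + \<gamma>) \<le> real (card (injections ?a (verts B')))"
      using large vB' by (simp add: q_def)
    have fB': "finite (verts B')" using vB' by simp
    note * = num_embeddings_almost_uniform[OF A uB' fB' assms(1) close large' g eg'(2)]
    show "0 < num_embeddings (k + 1) A B" using *(1) assB' by simp
    show "\<bar>real (num_embeddings k A' B') / real (num_embeddings (k + 1) A B) - rho k A\<bar> \<le> \<epsilon>"
      if "hypergraphing k A' A" using *(2)[OF _ _ that] assB' by simp
  qed
  have "B \<in> finite_kay_graphs k"
    using kay_graph_associated[OF uH] vB by (simp add: finite_kay_graphs_def B_def[symmetric])
  moreover have "embeddings (k + 1) A B \<noteq> {}"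
    using main(1)[OF HB] by (auto simp: num_embeddings_def)
  ultimately show ?thesis using main(2) by blast
qed

end
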